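(* Let $p_1<p_2$ be finite real numbers, let $I\subset\mathbb{R}$ be an open interval containing $[p_1,p_2]$, let $\rho>1$ and $\mu\in(0,1]$ be real numbers, and let $p_0\in[p_1,p_2]$. Let $\psi:I\to\mathbb{R}$ belong to $\mathcal{C}^2(I)$ and suppose there is a function $\tilde\psi:I\to\mathbb{R}$ such that $\psi'(p)=|p-p_0|^{\rho-1}\,\tilde\psi(p)$ for all $p\in I$, where $|\tilde\psi|:I\to\mathbb{R}$ is continuous and does not vanish on $I$. Let $U:(p_1,p_2]\to\mathbb{C}$ and suppose there is a function $\tilde u:[p_1,p_2]\to\mathbb{C}$, continuous on $[p_1,p_2]$, differentiable on $(p_1,p_2)$ with $\tilde u'\in L^1((p_1,p_2),\mathbb{C})$, and with $\tilde u(p_1)\neq 0$ if $\mu\neq 1$, such that $U(p)=(p-p_1)^{\mu-1}\,\tilde u(p)$ for all $p\in(p_1,p_2]$. Suppose moreover that $\psi'$ is monotone on $I_{p_0}^-:=\{p\in I : p\leqslant p_0\}$ and monotone on $I_{p_0}^+:=\{p\in I : p\geqslant p_0\}$. Then for all $\omega>0$, $$\left|\int_{p_1}^{p_2}U(p)\,e^{i\omega\psi(p)}\,dp\right|\leqslant C(U,\psi)\,\omega^{-\frac{\mu}{\rho}},$$ where $$C(U,\psi):=\frac{3}{\mu}\,\|\tilde u\|_{L^\infty(p_1,p_2)}+\Big(8\,\|\tilde u\|_{L^\infty(p_1,p_2)}+2\,\|\tilde u'\|_{L^1(p_1,p_2)}\Big)\Big(\min_{p\in[p_1,p_2]}|\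tilde\psi(p)|\Big)^{-1}.$$
   Context: All notation is standard. The function $\tilde\psi$ itself is not assumed continuous at $p_0$ (its sign may change there); only $|\tilde\psi|$ is assumed continuous on $I$. *)

theory Defs
  imports "HOL-Analysis.Analysis" "HOL-Probability.Essential_Supremum"
begin

text \<open>Intended for open \<open>S\<close>, where the two-sided derivatives are insensitive to the values of
  \<open>f\<close> outside \<open>S\<close>.\<close>

definition C2_on :: "(real \<Rightarrow> real) \<Rightarrow> real set \<Rightarrow> bool" where
  "C2_on f S \<longleftrightarrow> f C1_differentiable_on S \<and> deriv f C1_differentiable_on S"

text \<open>For \<open>f\<close> non-measurable or essentially unbounded on \<open>S\<close> the essential supremum is infinite
  and \<open>Linf_norm\<close> is \<open>0\<close>; use it only for essentially bounded \<open>f\<close>.\<close>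

definition Linf_norm :: "real set \<Rightarrow> (real \<Rightarrow> complex) \<Rightarrow> real" where
  "Linf_norm S f = real_of_ereal (esssup (restrict_space lborel S) (\<lambda>p. ereal (norm (f p))))"

definition L1_norm :: "real set \<Rightarrow> (real \<Rightarrow> complex) \<Rightarrow> real" where
  "L1_norm S f = (LINT p:S|lborel. norm (f p))"

text \<open>The minimum of \<open>f\<close> on \<open>S\<close>, meaningful when it is attained. (\<^const>\<open>Min\<close> covers only
  finite sets.)\<close>

definition min_on :: "real set \<Rightarrow> (real \<Rightarrow> real) \<Rightarrow> real" where
  "min_on S f = (LEAST m. m \<in> f ` S)"

text \<open>The constant depends on \<open>U\<close> and \<open>\<psi>\<close> through \<open>\<mu>\<close> and the factors \<open>ut\<close>, \<open>\<psi>t\<close>.\<close>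

definition C_const :: "real \<Rightarrow> real \<Rightarrow> real \<Rightarrow> (real \<Rightarrow> complex) \<Rightarrow> (real \<Rightarrow> real) \<Rightarrow> real" where
  "C_const p1 p2 \<mu> ut \<psi>t =
     3 / \<mu> * Linf_norm {p1<..<p2} ut
     + (8 * Linf_norm {p1<..<p2} ut
        + 2 * L1_norm {p1<..<p2} (\<lambda>p. vector_derivative ut (at p)))
       * inverse (min_on {p1..p2} (\<lambda>p. \<bar>\<psi>t p\<bar>))"

end

theory Submission
  imports Defs
begin

text \<open>With \<open>\<delta> = \<omega> powr (-1/\<rho>)\<close>, remove from \<open>{p1<..p2}\<close> the points within distance \<open>\<delta>\<close> of
  \<open>p1\<close> or of \<open>p0\<close>. The absolute value of the integrand contributes at most
  \<open>3/\<mu> * \<parallel>ut\<parallel> * \<delta> powr \<mu>\<close> there. With \<open>m\<close> the minimum of \<open>\<bar>\<psi>t\<bar>\<close>, on each of the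
  at most two remaining intervals \<open>\<bar>deriv \<psi>\<bar> \<ge> m * \<delta> powr (\<rho> - 1)\<close> and
  \<open>(p - p1) powr (\<mu> - 1) \<le> \<delta> powr (\<mu> - 1)\<close>, and one integration by parts suffices, since
  \<open>1 / deriv \<psi>\<close> is monotone and of constant sign.\<close>

section \<open>One integration by parts against an oscillating exponential\<close>

text \<open>Writing the exponential as its own derivative divided by
  \<open>\<i> * \<omega> * f\<close> moves the derivative onto \<open>w\<close>,
  \<open>1 / f\<close> and \<open>u\<close>. The first two are monotone, so the integrals of the
  absolute values of their derivatives are differences of endpoint values, at most \<open>W\<close>
  and \<open>1 / c\<close>. In units of \<open>W / (c * \<omega>)\<close>, the two boundary terms
  cost \<open>2 * M\<close>, the variations of \<open>w\<close> and \<open>1 / f\<close> cost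
  \<open>M\<close> each, and the derivative of \<open>u\<close> costs its L1 norm.\<close>

lemma van_der_Corput_weighted:
  fixes \<phi> f f' w w' :: "real \<Rightarrow> real" and u u' :: "real \<Rightarrow> complex"
  assumes ab: "a \<le> b" and \<omega>: "0 < \<omega>" and c: "0 < c" and M: "0 \<le> M" and W: "0 \<le> W"
    and \<phi>: "\<And>p. p \<in> {a..b} \<Longrightarrow> (\<phi> has_real_derivative f p) (at p)"
    and f: "\<And>p. p \<in> {a..b} \<Longrightarrow> (f has_real_derivative f' p) (at p)"
    and w: "\<And>p. p \<in> {a..b} \<Longrightarrow> (w has_real_derivative w' p) (at p)"
    and u: "continuous_on {a..b} u"
    and u': "\<And>p. p \<in> {a<..<b} \<Longrightarrow> (u has_vector_derivative u' p) (at p)"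
    and iu': "(\<lambda>p. norm (u' p)) integrable_on {a..b}"
    and f'_sgn: "(\<forall>p\<in>{a..b}. 0 \<le> f' p) \<or> (\<forall>p\<in>{a..b}. f' p \<le> 0)"
    and f_sgn: "(\<forall>p\<in>{a..b}. c \<le> f p) \<or> (\<forall>p\<in>{a..b}. f p \<le> - c)"
    and w'_sgn: "\<And>p. p \<in> {a..b} \<Longrightarrow> w' p \<le> 0"
    and w0: "\<And>p. p \<in> {a..b} \<Longrightarrow> 0 \<le> w p" and wW: "\<And>p. p \<in> {a..b} \<Longrightarrow> w p \<le> W"
    and uM: "\<And>p. p \<in> {a..b} \<Longrightarrow> norm (u p) \<le> M"
  shows "cmod (integral {a..b} (\<lambda>p. of_real (w p) * u p * exp (\<i> * of_real (\<omega> * \<phi> p))))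
    \<le> (4 * M + integral {a..b} (\<lambda>p. norm (u' p))) * (W / (c * \<omega>))"
proof -
  define h where "h = (\<lambda>p. 1 / f p)"
  define h' where "h' = (\<lambda>p. - f' p / (f p)\<^sup>2)"
  define e where "e = (\<lambda>p. exp (\<i> * of_real (\<omega> * \<phi> p)))"
  define G where "G = (\<lambda>p. of_real (w p) * u p * e p)"
  define F where "F = (\<lambda>p. of_real (w p * h p) * u p * e p / (\<i> * of_real \<omega>))"
  define R where "R = (\<lambda>p. (of_real (w' p * h p + w p * h' p) * u p
      + of_real (w p * h p) * u' p) * e p / (\<i> * of_real \<omega>))"
  have f_ge: "c \<le> \<bar>f p\<bar>" if "p \<in> {a..b}" for p
    using f_sgn that by fastforce
  have f0: "f p \<noteq> 0" if "p \<in> {a..b}" for p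
    using f_ge[OF that] c by auto
  have h_le: "\<bar>h p\<bar> \<le> 1 / c" if "p \<in> {a..b}" for p
    using f_ge[OF that] c by (simp add: h_def abs_divide frac_le)
  have dh: "(h has_real_derivative h' p) (at p)" if "p \<in> {a..b}" for p
    unfolding h_def h'_def using f0[OF that]
    by (auto intro!: derivative_eq_intros f that simp: power2_eq_square)
  have de: "(e has_vector_derivative \<i> * of_real (\<omega> * f p) * e p) (at p)" if "p \<in> {a..b}" for p
  proof -
    have "((\<lambda>p. of_real (\<omega> * \<phi> p)) has_vector_derivative complex_of_real (\<omega> * f p)) (at p)"
      using \<phi>[OF that]
      by (intro has_vector_derivative_of_real) (auto intro!: derivative_eq_intros)
    then have "((\<lambda>p. \<i> * of_real (\<omega> * \<phi> p)) has_vector_derivative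
        \<i> * complex_of_real (\<omega> * f p)) (at p)"
      by (rule has_vector_derivative_mult_right)
    then have "((exp \<circ> (\<lambda>p. \<i> * of_real (\<omega> * \<phi> p))) has_vector_derivative
        (\<i> * complex_of_real (\<omega> * f p)) * exp (\<i> * of_real (\<omega> * \<phi> p))) (at p)"
      by (rule field_vector_diff_chain_at) (rule DERIV_exp)
    then show ?thesis by (simp add: e_def o_def)
  qed
  have ne: "norm (e p) = 1" for p
    by (simp add: e_def norm_exp_eq_Re)
  have cont: "continuous_on {a..b} w" "continuous_on {a..b} h" "continuous_on {a..b} e"
    using w dh de by (meson DERIV_isCont continuous_at_imp_continuous_on,
      meson DERIV_isCont continuous_at_imp_continuous_on,
      meson has_vector_derivative_continuous continuous_at_imp_continuous_on)
  have cF: "continuous_on {a..b} F"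
    unfolding F_def using \<omega> by (intro continuous_intros cont u) auto
  have iG: "G integrable_on {a..b}"
    unfolding G_def by (intro integrable_continuous_real continuous_intros cont u)
  have dF: "(F has_vector_derivative (G p + R p)) (at p)" if p: "p \<in> {a<..<b}" for p
  proof -
    have pab: "p \<in> {a..b}" using p by auto
    have 1: "((\<lambda>p. w p * h p) has_real_derivative (w' p * h p + w p * h' p)) (at p)"
      by (auto intro!: derivative_eq_intros w dh pab)
    have "((\<lambda>p. of_real (w p * h p) * u p * e p) has_vector_derivative
       (of_real (w p * h p) * u p * (\<i> * of_real (\<omega> * f p) * e p)
        + (of_real (w p * h p) * u' p + of_real (w' p * h p + w p * h' p) * u p) * e p)) (at p)"
      by (intro has_vector_derivative_mult has_vector_derivative_of_real 1 u' p de pab)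
    then have "((\<lambda>p. (of_real (w p * h p) * u p * e p) / (\<i> * of_real \<omega>)) has_vector_derivative
       (of_real (w p * h p) * u p * (\<i> * of_real (\<omega> * f p) * e p)
        + (of_real (w p * h p) * u' p + of_real (w' p * h p + w p * h' p) * u p) * e p)
          / (\<i> * of_real \<omega>)) (at p)"
      by (rule has_vector_derivative_divide)
    moreover have "(of_real (w p * h p) * u p * (\<i> * of_real (\<omega> * f p) * e p)
        + (of_real (w p * h p) * u' p + of_real (w' p * h p + w p * h' p) * u p) * e p)
          / (\<i> * of_real \<omega>) = G p + R p"
      using \<omega> f0[OF pab] unfolding G_def R_def h_def by (simp add: field_simps)
    ultimately show ?thesis by (simp add: F_def)
  qed
  \<comment> \<open>\<open>u\<close> is differentiable only in the open interval, so the fundamental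
    theorem is used in the form that asks for continuity of \<open>F\<close> up to the endpoints.
    The integrability of \<open>R\<close> then follows by subtracting the continuous function
    \<open>G\<close>.\<close>
  have hiF: "((\<lambda>p. G p + R p) has_integral (F b - F a)) {a..b}"
    by (rule fundamental_theorem_of_calculus_interior[OF ab cF dF]) auto
  have hiR: "(R has_integral (F b - F a - integral {a..b} G)) {a..b}"
    using has_integral_diff[OF hiF integrable_integral[OF iG]] by simp
  have hiw: "((\<lambda>p. - w' p) has_integral (- (w b - w a))) {a..b}"
    by (intro has_integral_neg fundamental_theorem_of_calculus[OF ab])
      (use w has_real_derivative_iff_has_vector_derivative has_vector_derivative_at_within in blast)
  have hih: "(h' has_integral (h b - h a)) {a..b}"
    by (rule fundamental_theorem_of_calculus[OF ab])
      (use dh has_real_derivative_iff_has_vector_derivative has_vector_derivative_at_within in blast)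
  have h'_sgn: "(\<forall>p\<in>{a..b}. 0 \<le> h' p) \<or> (\<forall>p\<in>{a..b}. h' p \<le> 0)"
    using f'_sgn by (auto simp: h'_def divide_nonpos_nonneg)
  \<comment> \<open>Because \<open>h'\<close> keeps one sign, its total variation telescopes to the
    difference of the endpoint values.\<close>
  have hih': "((\<lambda>p. \<bar>h' p\<bar>) has_integral \<bar>h b - h a\<bar>) {a..b}"
    using h'_sgn
  proof
    assume *: "\<forall>p\<in>{a..b}. 0 \<le> h' p"
    then have "0 \<le> h b - h a" using has_integral_nonneg[OF hih] by auto
    with * show ?thesis using has_integral_eq[of "{a..b}" h' "\<lambda>p. \<bar>h' p\<bar>"] hih by simp
  next
    assume *: "\<forall>p\<in>{a..b}. h' p \<le> 0"
    have n: "((\<lambda>p. - h' p) has_integral (- (h b - h a))) {a..b}"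
      by (rule has_integral_neg[OF hih])
    then have "0 \<le> - (h b - h a)" using has_integral_nonneg[OF n] * by auto
    with * show ?thesis using has_integral_eq[of "{a..b}" "\<lambda>p. - h' p" "\<lambda>p. \<bar>h' p\<bar>"] n
      by simp
  qed
  \<comment> \<open>The triangle inequality alone would give \<open>2 / c\<close>, and
    \<open>5 * M\<close> in the conclusion. Since \<open>h a\<close> and \<open>h b\<close> have the
    same sign, their difference is at most the larger of their absolute values.\<close>
  have hba: "\<bar>h b - h a\<bar> \<le> 1 / c"
  proof -
    have "(0 \<le> h a \<and> 0 \<le> h b) \<or> (h a \<le> 0 \<and> h b \<le> 0)"
      using f_sgn
    proof
      assume "\<forall>p\<in>{a..b}. c \<le> f p"
      then have "c \<le> f a" "c \<le> f b" using ab by auto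
      then show ?thesis using c by (simp add: h_def)
    next
      assume "\<forall>p\<in>{a..b}. f p \<le> - c"
      then have "f a \<le> - c" "f b \<le> - c" using ab by auto
      then show ?thesis using c by (simp add: h_def)
    qed
    then show ?thesis using h_le[of a] h_le[of b] ab by auto
  qed
  \<comment> \<open>A majorant of \<open>norm (R p)\<close>: one term for each factor hit by the
    derivative, with the other two factors replaced by their bounds. The first two terms integrate
    exactly.\<close>
  define B where "B = (\<lambda>p. ((M / c) * (- w' p) + (M * W) * \<bar>h' p\<bar> + (W / c) * norm (u' p)) / \<omega>)"
  have hiB: "(B has_integral ((M / c) * (- (w b - w a)) + (M * W) * \<bar>h b - h a\<bar>
      + (W / c) * integral {a..b} (\<lambda>p. norm (u' p))) / \<omega>) {a..b}"
    unfolding B_def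
    by (intro has_integral_divide has_integral_add has_integral_mult_right hiw hih'
        integrable_integral iu')
  have RB: "norm (R p) \<le> B p" if p: "p \<in> {a..b}" for p
  proof -
    have wh: "\<bar>w p * h p\<bar> \<le> W / c"
      using mult_mono[OF wW[OF p] h_le[OF p]] w0[OF p] W by (simp add: abs_mult)
    have "\<bar>w' p * h p + w p * h' p\<bar> \<le> \<bar>w' p\<bar> * \<bar>h p\<bar> + \<bar>w p\<bar> * \<bar>h' p\<bar>"
      by (metis abs_mult abs_triangle_ineq)
    also have "\<dots> \<le> (- w' p) * (1 / c) + W * \<bar>h' p\<bar>"
      using w'_sgn[OF p] w0[OF p] wW[OF p] h_le[OF p]
      by (intro add_mono mult_mono) auto
    finally have d: "\<bar>w' p * h p + w p * h' p\<bar> \<le> (- w' p) * (1 / c) + W * \<bar>h' p\<bar>" .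
    have "norm (of_real (w' p * h p + w p * h' p) * u p + of_real (w p * h p) * u' p)
        \<le> \<bar>w' p * h p + w p * h' p\<bar> * norm (u p) + \<bar>w p * h p\<bar> * norm (u' p)"
      by (rule order_trans[OF norm_triangle_ineq]) (simp only: norm_mult norm_of_real order_refl)
    also have "\<dots> \<le> ((- w' p) * (1 / c) + W * \<bar>h' p\<bar>) * M + (W / c) * norm (u' p)"
      using d wh uM[OF p] M by (intro add_mono mult_mono) auto
    finally have "norm (of_real (w' p * h p + w p * h' p) * u p + of_real (w p * h p) * u' p)
        \<le> (M / c) * (- w' p) + (M * W) * \<bar>h' p\<bar> + (W / c) * norm (u' p)"
      by (simp add: algebra_simps)
    then show ?thesis
      using \<omega> unfolding R_def B_def norm_divide norm_mult ne
      by (simp add: divide_right_mono)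
  qed
  have "norm (integral {a..b} R) \<le> integral {a..b} B"
    using hiR hiB RB by (intro integral_norm_bound_integral) auto
  then have nR: "norm (F b - F a - integral {a..b} G)
      \<le> ((M / c) * (- (w b - w a)) + (M * W) * \<bar>h b - h a\<bar>
      + (W / c) * integral {a..b} (\<lambda>p. norm (u' p))) / \<omega>"
    using hiR hiB by (simp add: integral_unique)
  also have "\<dots> \<le> ((M / c) * W + (M * W) * (1 / c)
      + (W / c) * integral {a..b} (\<lambda>p. norm (u' p))) / \<omega>"
    using M W c \<omega> hba w0[of b] wW[of a] ab
    by (intro divide_right_mono add_mono mult_left_mono) auto
  finally have nR: "norm (F b - F a - integral {a..b} G) \<le> \<dots>" .
  have nF: "norm (F p) \<le> M * W / c / \<omega>" if p: "p \<in> {a..b}" for p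
  proof -
    have "norm (F p) = w p * \<bar>h p\<bar> * norm (u p) / \<omega>"
      using \<omega> w0[OF p] by (simp add: F_def norm_divide norm_mult ne abs_mult)
    also have "\<dots> \<le> W * (1 / c) * M / \<omega>"
      using \<omega> w0[OF p] wW[OF p] h_le[OF p] uM[OF p] W c
      by (intro divide_right_mono mult_mono) auto
    finally show ?thesis by (simp add: mult_ac)
  qed
  have "integral {a..b} G = F b - F a - (F b - F a - integral {a..b} G)" by simp
  then have "norm (integral {a..b} G)
      \<le> norm (F b) + norm (F a) + norm (F b - F a - integral {a..b} G)"
    by (metis norm_triangle_ineq4 order_trans add_right_mono)
  also have "\<dots> \<le> M * W / c / \<omega> + M * W / c / \<omega> + ((M / c) * W + (M * W) * (1 / c)
      + (W / c) * integral {a..b} (\<lambda>p. norm (u' p))) / \<omega>"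
    using nF[of a] nF[of b] nR ab by (intro add_mono) auto
  also have "\<dots> = (4 * M + integral {a..b} (\<lambda>p. norm (u' p))) * (W / (c * \<omega>))"
    by (simp add: algebra_simps add_divide_distrib)
  finally show ?thesis by (simp add: G_def e_def)
qed

section \<open>The integral of the singular weight\<close>

text \<open>For \<open>\<mu> < 1\<close> the integrand is unbounded near \<open>a\<close>, but the
  antiderivative \<open>(p - a) powr \<mu> / \<mu>\<close> is continuous at \<open>a\<close> because
  \<open>0 < \<mu>\<close>, so differentiability in the interior is enough.\<close>

lemma has_integral_powr_shift:
  fixes a x \<mu> :: real
  assumes "0 < \<mu>" "a \<le> x"
  shows "((\<lambda>p. (p - a) powr (\<mu> - 1)) has_integral (x - a) powr \<mu> / \<mu>) {a..x}"
proof -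
  have "((\<lambda>p. (p - a) powr (\<mu> - 1)) has_integral
      ((x - a) powr \<mu> / \<mu> - (a - a) powr \<mu> / \<mu>)) {a..x}"
  proof (rule fundamental_theorem_of_calculus_interior[OF assms(2)])
    show "continuous_on {a..x} (\<lambda>p. (p - a) powr \<mu> / \<mu>)"
      using assms by (intro continuous_intros continuous_on_powr') auto
    show "((\<lambda>p. (p - a) powr \<mu> / \<mu>) has_vector_derivative (p - a) powr (\<mu> - 1)) (at p)"
      if "p \<in> {a<..<x}" for p
      unfolding has_real_derivative_iff_has_vector_derivative[symmetric]
      using that assms by (auto intro!: derivative_eq_intros)
  qed
  then show ?thesis using assms by simp
qed

text \<open>The gauge integral becomes a Lebesgue integral because the weight is nonnegative, hence
  absolutely integrable; dropping the single point \<open>a\<close> changes no integral.\<close>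

lemma
  fixes a x \<mu> :: real
  assumes "0 < \<mu>" "a \<le> x"
  shows set_integrable_powr_shift: "set_integrable lborel {a<..x} (\<lambda>p. (p - a) powr (\<mu> - 1))"
    and LINT_powr_shift: "(LINT p:{a<..x}|lborel. (p - a) powr (\<mu> - 1)) = (x - a) powr \<mu> / \<mu>"
proof -
  let ?w = "\<lambda>p. (p - a) powr (\<mu> - 1)"
  note hi = has_integral_powr_shift[OF assms]
  have "?w absolutely_integrable_on {a..x}"
    using hi by (intro nonnegative_absolutely_integrable_1) auto
  then have "set_integrable lebesgue {a<..x} ?w"
    by (rule set_integrable_subset) auto
  then show i: "set_integrable lborel {a<..x} ?w"
    unfolding set_integrable_def by (subst (asm) integrable_completion) auto
  have "(LINT p:{a<..x}|lborel. ?w p) = integral {a<..x} ?w"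
    using i by (rule set_borel_integral_eq_integral)
  also have "\<dots> = integral {a..x} ?w"
    by (rule integral_subset_negligible[OF _ negligible_subset[of "{a}"]]) auto
  finally show "(LINT p:{a<..x}|lborel. ?w p) = (x - a) powr \<mu> / \<mu>"
    using hi by (simp add: integral_unique)
qed

section \<open>Pointwise bounds from the essential supremum and the minimum\<close>

text \<open>The essential supremum bounds \<open>norm (u p)\<close> only almost everywhere. If the
  bound failed at some \<open>x\<close>, possibly an endpoint, continuity would make it fail on a
  whole subinterval of positive length, which is not a null set.\<close>

lemma norm_le_Linf_norm:
  fixes u :: "real \<Rightarrow> complex"
  assumes ab: "a < b" and u: "continuous_on {a..b} u" and x: "x \<in> {a..b}"
  shows "norm (u x) \<le> Linf_norm {a<..<b} u"
proof -
  let ?M = "restrict_space lborel {a<..<b}"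
  let ?E = "esssup ?M (\<lambda>p. ereal (norm (u p)))"
  have cu: "continuous_on {a<..<b} u"
    using u by (rule continuous_on_subset) auto
  have meas: "(\<lambda>p. ereal (norm (u p))) \<in> borel_measurable ?M"
  proof -
    have "u \<in> borel_measurable (restrict_space borel {a<..<b})"
      using cu by (rule borel_measurable_continuous_on_restrict)
    then have "u \<in> borel_measurable ?M"
      by (simp cong: measurable_cong_sets add: sets_restrict_space)
    then show ?thesis by measurable
  qed
  obtain K where K: "\<And>p. p \<in> {a..b} \<Longrightarrow> norm (u p) \<le> K"
    using compact_imp_bounded[OF compact_continuous_image[OF u compact_Icc]]
    unfolding bounded_iff by blast
  have ub: "?E \<le> ereal K"
    using meas K by (intro esssup_I) (auto simp: AE_restrict_space_iff)
  have AE1: "AE p in lborel. p \<in> {a<..<b} \<longrightarrow> ereal (norm (u p)) \<le> ?E"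
    using esssup_AE[of "\<lambda>p. ereal (norm (u p))" ?M] by (simp add: AE_restrict_space_iff)
  have dense: "\<exists>p\<in>{c<..<d}. ereal (norm (u p)) \<le> ?E" if "a \<le> c" "c < d" "d \<le> b" for c d
  proof (rule ccontr)
    assume "\<not> ?thesis"
    then have "AE p in lborel. p \<notin> {c<..<d}"
      using AE1 that by (auto elim!: eventually_mono)
    then have "emeasure lborel {c<..<d} = 0"
      by (subst (asm) AE_iff_measurable[of "{c<..<d}"]) auto
    then show False using that by (simp add: emeasure_lborel_Ioo)
  qed
  \<comment> \<open>Finiteness has to be shown because \<open>real_of_ereal\<close> sends both
    infinities to \<open>0\<close>. A point where the bound holds excludes minus infinity, and the
    bound \<open>K\<close> from compactness excludes plus infinity.\<close>
  obtain p0 where "ereal (norm (u p0)) \<le> ?E"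
    using dense[of a b] ab by auto
  then have fin: "\<bar>?E\<bar> \<noteq> \<infinity>"
    using ub by (cases ?E) auto
  have le: "norm (u p) \<le> Linf_norm {a<..<b} u" if "ereal (norm (u p)) \<le> ?E" for p
    using that fin unfolding Linf_norm_def by (cases ?E) auto
  show ?thesis
  proof (rule ccontr)
    assume "\<not> ?thesis"
    then have pos: "0 < norm (u x) - Linf_norm {a<..<b} u" by simp
    have "continuous_on {a..b} (\<lambda>p. norm (u p))" using u by (intro continuous_intros)
    then obtain d where d: "0 < d" and
      dd: "\<And>p. p \<in> {a..b} \<Longrightarrow> dist p x < d \<Longrightarrow>
         dist (norm (u p)) (norm (u x)) < norm (u x) - Linf_norm {a<..<b} u"
      using x pos unfolding continuous_on_iff by meson
    obtain p where "p \<in> {max a (x - d)<..<min b (x + d)}" "ereal (norm (u p)) \<le> ?E"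
      using dense[of "max a (x - d)" "min b (x + d)"] x d ab by auto
    moreover from this have "p \<in> {a..b}" "dist p x < d" by (auto simp: dist_real_def)
    ultimately show False using dd[of p] le[of p] by (auto simp: dist_real_def)
  qed
qed

lemma min_on_Icc:
  fixes f :: "real \<Rightarrow> real"
  assumes "a \<le> b" "continuous_on {a..b} f"
  shows "min_on {a..b} f \<in> f ` {a..b}" and "\<And>x. x \<in> {a..b} \<Longrightarrow> min_on {a..b} f \<le> f x"
proof -
  obtain x where x: "x \<in> {a..b}" "\<forall>y\<in>{a..b}. f x \<le> f y"
    using continuous_attains_inf[of "{a..b}" f] assms by auto
  then have "min_on {a..b} f = f x"
    unfolding min_on_def by (intro Least_equality) auto
  with x show "min_on {a..b} f \<in> f ` {a..b}" "\<And>x. x \<in> {a..b} \<Longrightarrow> min_on {a..b} f \<le> f x"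
    by auto
qed

lemma deriv_nonpos_of_antimono_on:
  fixes f :: "real \<Rightarrow> real"
  assumes "antimono_on S f" "x \<in> interior S" "(f has_real_derivative D) (at x)"
  shows "D \<le> 0"
proof -
  have "mono_on S (\<lambda>x. - f x)" using assms(1) by (auto simp: monotone_on_def)
  moreover have "((\<lambda>x. - f x) has_real_derivative - D) (at x)"
    using assms(3) by (rule DERIV_minus)
  ultimately have "0 \<le> - D" using mono_on_imp_deriv_nonneg assms(2) by blast
  then show ?thesis by simp
qed

theorem theorem1p2:
  fixes p1 p2 p0 \<rho> \<mu> :: real
    and I :: "real set"
    and \<psi> \<psi>t :: "real \<Rightarrow> real"
    and U ut :: "real \<Rightarrow> complex"
  assumes "p1 < p2"
    and "open I" and "is_interval I" and "{p1..p2} \<subseteq> I"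
    and "\<rho> > 1" and "0 < \<mu>" and "\<mu> \<le> 1"
    and "p0 \<in> {p1..p2}"
    and "C2_on \<psi> I"
    and "\<And>p. p \<in> I \<Longrightarrow> deriv \<psi> p = \<bar>p - p0\<bar> powr (\<rho> - 1) * \<psi>t p"
    and "continuous_on I (\<lambda>p. \<bar>\<psi>t p\<bar>)"
    and "\<And>p. p \<in> I \<Longrightarrow> \<bar>\<psi>t p\<bar> \<noteq> 0"
    and "continuous_on {p1..p2} ut"
    and "\<And>p. p \<in> {p1<..<p2} \<Longrightarrow> ut differentiable (at p)"
    and "set_integrable lborel {p1<..<p2} (\<lambda>p. vector_derivative ut (at p))"
    and "\<mu> \<noteq> 1 \<Longrightarrow> ut p1 \<noteq> 0"
    and "\<And>p. p \<in> {p1<..p2} \<Longrightarrow> U p = of_real ((p - p1) powr (\<mu> - 1)) * ut p"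
    and "mono_on {p \<in> I. p \<le> p0} (deriv \<psi>) \<or> antimono_on {p \<in> I. p \<le> p0} (deriv \<psi>)"
    and "mono_on {p \<in> I. p \<ge> p0} (deriv \<psi>) \<or> antimono_on {p \<in> I. p \<ge> p0} (deriv \<psi>)"
  shows "\<forall>\<omega>>0. cmod (LINT p:{p1<..p2}|lborel. U p * exp (\<i> * of_real (\<omega> * \<psi> p)))
           \<le> C_const p1 p2 \<mu> ut \<psi>t * \<omega> powr (- (\<mu> / \<rho>))"
proof (intro allI impI)
  note p12 = assms(1) and opI = assms(2) and sub = assms(4) and rho = assms(5)
    and mu0 = assms(6) and mu1 = assms(7) and p0 = assms(8) and psit = assms(10)
    and cut = assms(13) and dut = assms(14) and iut = assms(15) and U = assms(17)

  \<comment> \<open>Choice of scale and pointwise bounds for phase and amplitude\<close>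
  fix \<omega> :: real
  assume om: "0 < \<omega>"
  \<comment> \<open>This scale balances the two kinds of contribution. Near \<open>p1\<close> and
    \<open>p0\<close> the integral has order \<open>\<delta> powr \<mu>\<close>; elsewhere
    integration by parts gives order \<open>\<delta> powr (\<mu> - 1) / (\<delta> powr (\<rho> - 1)
    * \<omega>)\<close>. They agree exactly when
    \<open>\<omega> * \<delta> powr \<rho> = 1\<close>.\<close>
  define \<delta> where "\<delta> = \<omega> powr (- (1 / \<rho>))"
  define M where "M = Linf_norm {p1<..<p2} ut"
  define u' where "u' = (\<lambda>p. vector_derivative ut (at p))"
  define V where "V = L1_norm {p1<..<p2} u'"
  define m where "m = min_on {p1..p2} (\<lambda>p. \<bar>\<psi>t p\<bar>)"
  define w where "w = (\<lambda>p. (p - p1) powr (\<mu> - 1))"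
  define G where "G = (\<lambda>p. of_real (w p) * ut p * exp (\<i> * of_real (\<omega> * \<psi> p)))"
  define c where "c = m * \<delta> powr (\<rho> - 1)"
  have de0: "0 < \<delta>" using om by (simp add: \<delta>_def)
  have uM: "norm (ut p) \<le> M" if "p \<in> {p1..p2}" for p
    unfolding M_def using p12 cut that by (rule norm_le_Linf_norm)
  have M0: "0 \<le> M" using uM[of p1] p12 by (auto intro: order_trans[OF norm_ge_zero])
  have cpsit: "continuous_on {p1..p2} (\<lambda>p. \<bar>\<psi>t p\<bar>)"
    using assms(11) sub by (rule continuous_on_subset)
  have m: "m \<le> \<bar>\<psi>t p\<bar>" if "p \<in> {p1..p2}" for p
    unfolding m_def using min_on_Icc(2)[OF _ cpsit] p12 that by simp
  have m0: "0 < m"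
  proof -
    have "m \<in> (\<lambda>p. \<bar>\<psi>t p\<bar>) ` {p1..p2}"
      unfolding m_def using min_on_Icc(1)[OF _ cpsit] p12 by simp
    then show ?thesis using assms(12) sub by fastforce
  qed
  have c0: "0 < c" using m0 de0 by (simp add: c_def)
  obtain f where psi': "\<And>p. p \<in> I \<Longrightarrow> (\<psi> has_real_derivative f p) (at p)"
    using assms(9) unfolding C2_on_def C1_differentiable_on_def
      has_real_derivative_iff_has_vector_derivative by blast
  have dpsi: "(\<psi> has_real_derivative deriv \<psi> p) (at p)" if "p \<in> I" for p
    using psi'[OF that] DERIV_imp_deriv by metis
  obtain f' where f': "\<And>p. p \<in> I \<Longrightarrow> (deriv \<psi> has_real_derivative f' p) (at p)"
    using assms(9) unfolding C2_on_def C1_differentiable_on_def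
      has_real_derivative_iff_has_vector_derivative by blast
  have cpsi: "continuous_on {p1..p2} \<psi>"
    using dpsi sub by (meson DERIV_isCont continuous_at_imp_continuous_on subsetD)
  have du: "(ut has_vector_derivative u' p) (at p)" if "p \<in> {p1<..<p2}" for p
    unfolding u'_def using dut[OF that] vector_derivative_works by blast
  have psi'0: "deriv \<psi> p0 = 0"
    using psit[of p0] p0 sub by auto
  have psi'_ge: "c \<le> \<bar>deriv \<psi> p\<bar>" if "p \<in> {p1..p2}" "\<delta> \<le> \<bar>p - p0\<bar>" for p
  proof -
    have "\<delta> powr (\<rho> - 1) \<le> \<bar>p - p0\<bar> powr (\<rho> - 1)"
      using that de0 rho by (intro powr_mono2) auto
    then have "m * \<delta> powr (\<rho> - 1) \<le> \<bar>\<psi>t p\<bar> * \<bar>p - p0\<bar> powr (\<rho> - 1)"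
      using m[OF that(1)] m0 by (intro mult_mono) auto
    moreover have "p \<in> I" using that sub by auto
    ultimately show ?thesis by (simp add: psit c_def abs_mult mult.commute)
  qed
  have w_le: "w p \<le> \<delta> powr (\<mu> - 1)" if "p1 + \<delta> \<le> p" for p
    unfolding w_def using that de0 mu1 by (intro powr_mono2') auto
  have w0: "0 \<le> w p" for p by (simp add: w_def)

  \<comment> \<open>Integrability of the derivative, the weight and the integrand\<close>
  have L1: "set_integrable lborel {p1<..<p2} (\<lambda>p. norm (u' p))"
    using iut unfolding u'_def by (rule set_integrable_norm)
  have iV: "(\<lambda>p. norm (u' p)) integrable_on {p1..p2}"
    using set_borel_integral_eq_integral(1)[OF L1] by (simp add: integrable_on_Icc_iff_Ioo)
  have V: "V = integral {p1..p2} (\<lambda>p. norm (u' p))"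
    unfolding V_def L1_norm_def integral_open_interval_real
    by (rule set_borel_integral_eq_integral(2)[OF L1])

  have iw: "set_integrable lborel {p1<..x} w" "(LINT p:{p1<..x}|lborel. w p) = (x - p1) powr \<mu> / \<mu>"
    if "p1 \<le> x" for x
    unfolding w_def using set_integrable_powr_shift[OF mu0 that] LINT_powr_shift[OF mu0 that] by auto
  have nG: "norm (G p) = w p * norm (ut p)" for p
    using w0[of p] by (simp add: G_def norm_mult norm_exp_eq_Re)
  \<comment> \<open>The integrand may blow up at \<open>p1\<close>, so it is dominated by the
    integrable function \<open>M * w\<close>; measurability comes from continuity on the half-open
    interval.\<close>
  have iG: "set_integrable lborel {p1<..p2} G"
  proof (rule set_integrable_bound)
    show "set_integrable lborel {p1<..p2} (\<lambda>p. M * w p)"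
      using iw(1)[of p2] p12 by simp
    have "continuous_on {p1<..p2} G"
      unfolding G_def w_def
      by (intro continuous_intros continuous_on_subset[OF cut] continuous_on_subset[OF cpsi]) auto
    then show "set_borel_measurable lborel {p1<..p2} G"
      unfolding set_borel_measurable_def
      by (simp add: borel_measurable_continuous_on_indicator)
    have "norm (G p) \<le> norm (M * w p)" if "p \<in> {p1<..p2}" for p
      using mult_right_mono[OF uM[of p] w0[of p]] that w0[of p] M0
      by (simp add: nG abs_mult mult.commute)
    then show "AE p in lborel. p \<in> {p1<..p2} \<longrightarrow> norm (G p) \<le> norm (M * w p)"
      by blast
  qed

  \<comment> \<open>Intervals at distance at least \<open>\<delta>\<close> from \<open>p1\<close>
    and from \<open>p0\<close>\<close>
  have scale: "\<delta> powr (\<mu> - 1) / (c * \<omega>) = \<delta> powr \<mu> / m"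
  proof -
    have "\<omega> = \<delta> powr (- \<rho>)" using om rho by (simp add: \<delta>_def powr_powr)
    then have "c * \<omega> = m * (\<delta> powr (\<rho> - 1) * \<delta> powr (- \<rho>))"
      by (simp add: c_def mult.assoc)
    also have "\<dots> = m / \<delta>"
      using de0 by (simp add: powr_diff powr_minus field_simps)
    finally show ?thesis using de0 m0 by (simp add: powr_diff field_simps)
  qed
  \<comment> \<open>\<open>S\<close> stands for the part of \<open>I\<close> on one side of
    \<open>p0\<close>, so that both sides share one argument. The inclusion in the interior of
    \<open>S\<close> lets the monotonicity of \<open>deriv \<psi>\<close> fix the sign of its
    derivative \<open>f'\<close>.\<close>
  have far: "norm (LINT p:{a..b}|lborel. G p) \<le> (4 * M + V) * (\<delta> powr \<mu> / m)"
    if S: "mono_on S (deriv \<psi>) \<or> antimono_on S (deriv \<psi>)" and abS: "{a..b} \<subseteq> interior S"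
      and p0S: "p0 \<in> S" and ap: "p1 + \<delta> \<le> a" and bp: "b \<le> p2"
      and far: "\<And>p. p \<in> {a..b} \<Longrightarrow> \<delta> \<le> \<bar>p - p0\<bar>"
      and side: "b \<le> p0 \<or> p0 \<le> a" for a b S
  proof (cases "a \<le> b")
    \<comment> \<open>The interval may be empty, for instance
      \<open>{p1 + \<delta>..p0 - \<delta>}\<close> when \<open>p0\<close> is closer to
      \<open>p1\<close> than \<open>2 * \<delta>\<close>; then only nonnegativity of the bound is at
      stake.\<close>
    case False
    then show ?thesis
      using M0 m0 V integral_nonneg[OF iV] by (simp add: set_lebesgue_integral_def)
  next
    case ab: True
    have absub: "{a..b} \<subseteq> {p1<..p2}" using ap bp de0 by auto
    have abI: "p \<in> I" "p \<in> {p1..p2}" "p \<in> S" if "p \<in> {a..b}" for p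
    proof -
      show p: "p \<in> {p1..p2}" using subsetD[OF absub that] by simp
      show "p \<in> I" using sub p by (rule subsetD)
      show "p \<in> S" using that abS interior_subset by blast
    qed
    have "(LINT p:{a..b}|lborel. G p) = integral {a..b} G"
      by (rule set_borel_integral_eq_integral(2)) (rule set_integrable_subset[OF iG _ absub], simp)
    also have "norm \<dots> \<le> (4 * M + integral {a..b} (\<lambda>p. norm (u' p))) * (\<delta> powr (\<mu> - 1) / (c * \<omega>))"
      unfolding G_def
    proof (rule van_der_Corput_weighted[where f = "deriv \<psi>" and f' = f'
          and w' = "\<lambda>p. (\<mu> - 1) * (p - p1) powr (\<mu> - 1 - 1)"])
      show "continuous_on {a..b} ut" using cut by (rule continuous_on_subset) (use abI in auto)
      show "(\<lambda>p. norm (u' p)) integrable_on {a..b}"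
        by (rule integrable_on_subinterval[OF iV]) (use abI in auto)
      show "(\<forall>p\<in>{a..b}. 0 \<le> f' p) \<or> (\<forall>p\<in>{a..b}. f' p \<le> 0)"
        using S
      proof
        assume "mono_on S (deriv \<psi>)"
        then have "0 \<le> f' p" if "p \<in> {a..b}" for p
          by (rule mono_on_imp_deriv_nonneg[OF _ f'[OF abI(1)[OF that]] subsetD[OF abS that]])
        then show ?thesis by blast
      next
        assume "antimono_on S (deriv \<psi>)"
        then have "f' p \<le> 0" if "p \<in> {a..b}" for p
          by (rule deriv_nonpos_of_antimono_on[OF _ subsetD[OF abS that] f'[OF abI(1)[OF that]]])
        then show ?thesis by blast
      qed
      \<comment> \<open>The sign of \<open>deriv \<psi>\<close> is read off from its zero at
        \<open>p0\<close> and its monotonicity on \<open>S\<close>, not from \<open>\<psi>t\<close>.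
        With the lower bound \<open>c\<close> on the absolute value this becomes a one-sided
        bound.\<close>
      have "(\<forall>p\<in>{a..b}. 0 \<le> deriv \<psi> p) \<or> (\<forall>p\<in>{a..b}. deriv \<psi> p \<le> 0)"
        using S
      proof
        assume "mono_on S (deriv \<psi>)"
        then have *: "deriv \<psi> p \<le> deriv \<psi> q" if "p \<in> S" "q \<in> S" "p \<le> q" for p q
          using that by (rule monotone_onD)
        then have "deriv \<psi> p \<le> 0" if "p \<in> {a..b}" "b \<le> p0" for p
          using psi'0 p0S abI(3)[OF that(1)] that by (metis atLeastAtMost_iff order_trans)
        moreover
        have "0 \<le> deriv \<psi> p" if "p \<in> {a..b}" "p0 \<le> a" for p
          using * psi'0 p0S abI(3)[OF that(1)] that by (metis atLeastAtMost_iff order_trans)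
        ultimately show ?thesis using side by blast
      next
        assume "antimono_on S (deriv \<psi>)"
        then have *: "deriv \<psi> q \<le> deriv \<psi> p" if "p \<in> S" "q \<in> S" "p \<le> q" for p q
          using that by (rule monotone_onD)
        then have "deriv \<psi> p \<ge> 0" if "p \<in> {a..b}" "b \<le> p0" for p
          using psi'0 p0S abI(3)[OF that(1)] that by (metis atLeastAtMost_iff order_trans)
        moreover
        have "0 \<ge> deriv \<psi> p" if "p \<in> {a..b}" "p0 \<le> a" for p
          using * psi'0 p0S abI(3)[OF that(1)] that by (metis atLeastAtMost_iff order_trans)
        ultimately show ?thesis using side by blast
      qed
      moreover have "c \<le> \<bar>deriv \<psi> p\<bar>" if "p \<in> {a..b}" for p
        using psi'_ge abI(2) far that by blast
      ultimately show "(\<forall>p\<in>{a..b}. c \<le> deriv \<psi> p) \<or> (\<forall>p\<in>{a..b}. deriv \<psi> p \<le> - c)"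
        by fastforce
      show "(w has_real_derivative (\<mu> - 1) * (p - p1) powr (\<mu> - 1 - 1)) (at p)"
        if "p \<in> {a..b}" for p
      proof -
        have "p1 < p" using that absub by auto
        then show ?thesis unfolding w_def by (auto intro!: derivative_eq_intros)
      qed
      show "(\<mu> - 1) * (p - p1) powr (\<mu> - 1 - 1) \<le> 0" for p
        using mu1 by (simp add: mult_nonpos_nonneg)
      show "(ut has_vector_derivative u' p) (at p)" if "p \<in> {a<..<b}" for p
        using that ap bp de0 by (intro du) auto
    qed (use ab om c0 M0 dpsi f' abI uM w0 w_le ap absub bp in auto)
    also have "\<dots> \<le> (4 * M + V) * (\<delta> powr \<mu> / m)"
      unfolding V scale using abI iV m0
      by (intro mult_right_mono add_left_mono integral_subset_le
          integrable_on_subinterval[OF iV]) auto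
    finally show ?thesis .
  qed

  \<comment> \<open>Splitting into two far intervals and a near set\<close>
  define S1 where "S1 = {p1 + \<delta>..p0 - \<delta>}"
  \<comment> \<open>No separate cut near \<open>p1\<close> is made here: \<open>p1 \<le> p0\<close>
    already gives \<open>p1 + \<delta> \<le> p0 + \<delta>\<close>.\<close>
  define S2 where "S2 = {p0 + \<delta>..p2}"
  define S3 where "S3 = {p1<..p2} - (S1 \<union> S2)"
  have S12: "S1 \<subseteq> {p1<..p2}" "S2 \<subseteq> {p1<..p2}" "S1 \<inter> S2 = {}"
    using p0 de0 by (auto simp: S1_def S2_def)
  have S_sets: "S1 \<in> sets lborel" "S2 \<in> sets lborel" "S3 \<in> sets lborel"
    by (auto simp: S1_def S2_def S3_def)
  have iG': "set_integrable lborel A G" if "A \<subseteq> {p1<..p2}" "A \<in> sets lborel" for A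
    using set_integrable_subset[OF iG] that by blast
  have split: "(LINT p:{p1<..p2}|lborel. G p)
      = (LINT p:S1|lborel. G p) + (LINT p:S2|lborel. G p) + (LINT p:S3|lborel. G p)"
  proof -
    have "{p1<..p2} = (S1 \<union> S2) \<union> S3" using S12 by (auto simp: S3_def)
    then have "(LINT p:{p1<..p2}|lborel. G p) = (LINT p:(S1 \<union> S2) \<union> S3|lborel. G p)" by simp
    also have "\<dots> = (LINT p:S1 \<union> S2|lborel. G p) + (LINT p:S3|lborel. G p)"
      using S12 S_sets by (intro set_integral_Un iG') (auto simp: S3_def)
    also have "(LINT p:S1 \<union> S2|lborel. G p) = (LINT p:S1|lborel. G p) + (LINT p:S2|lborel. G p)"
      using S12 S_sets by (intro set_integral_Un iG') auto
    finally show ?thesis .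
  qed
  have intI: "p \<in> interior {p \<in> I. p \<le> p0}" if "p \<in> I" "p < p0" for p
    by (rule interiorI[of "I \<inter> {..<p0}"]) (use opI that in auto)
  have intI': "p \<in> interior {p \<in> I. p0 \<le> p}" if "p \<in> I" "p0 < p" for p
    by (rule interiorI[of "I \<inter> {p0<..}"]) (use opI that in auto)
  have p0I: "p0 \<in> I" using p0 sub by auto
  have S1: "norm (LINT p:S1|lborel. G p) \<le> (4 * M + V) * (\<delta> powr \<mu> / m)"
    unfolding S1_def
  proof (rule far[OF assms(18)])
    show "{p1 + \<delta>..p0 - \<delta>} \<subseteq> interior {p \<in> I. p \<le> p0}"
    proof
      fix p assume "p \<in> {p1 + \<delta>..p0 - \<delta>}"
      then show "p \<in> interior {p \<in> I. p \<le> p0}"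
        using p0 sub de0 by (intro intI) auto
    qed
  qed (use p0I de0 p0 in auto)
  have S2: "norm (LINT p:S2|lborel. G p) \<le> (4 * M + V) * (\<delta> powr \<mu> / m)"
    unfolding S2_def
  proof (rule far[OF assms(19)])
    show "{p0 + \<delta>..p2} \<subseteq> interior {p \<in> I. p0 \<le> p}"
    proof
      fix p assume "p \<in> {p0 + \<delta>..p2}"
      then show "p \<in> interior {p \<in> I. p0 \<le> p}"
        using p0 sub de0 by (intro intI') auto
    qed
  qed (use p0I de0 p0 in auto)

  \<comment> \<open>The near set, estimated by absolute values\<close>
  have S3: "norm (LINT p:S3|lborel. G p) \<le> M * (3 / \<mu> * \<delta> powr \<mu>)"
  proof -
    \<comment> \<open>A point of \<open>S3\<close> is either within \<open>\<delta>\<close> of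
      \<open>p1\<close>, where the weight is integrated exactly, or farther from \<open>p1\<close>
      and within \<open>\<delta>\<close> of \<open>p0\<close>, where the weight is at most
      \<open>\<delta> powr (\<mu> - 1)\<close> on an interval of length \<open>2 * \<delta>\<close>.
      The two intervals may overlap or leave \<open>{p1<..p2}\<close>; this only enlarges the
      nonnegative majorant.\<close>
    let ?D = "\<lambda>p. M * (indicator {p1<..p1 + \<delta>} p * w p
        + indicator {p0 - \<delta>..p0 + \<delta>} p * \<delta> powr (\<mu> - 1))"
    have i1: "integrable lborel (\<lambda>p. indicator {p1<..p1 + \<delta>} p * w p)"
      using iw(1)[of "p1 + \<delta>"] de0 by (simp add: set_integrable_def)
    have i2: "integrable lborel (\<lambda>p. indicator {p0 - \<delta>..p0 + \<delta>} p * \<delta> powr (\<mu> - 1))"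
      by (intro integrable_mult_left integrable_real_indicator) (use de0 in auto)
    have "norm (LINT p:S3|lborel. G p) \<le> (LINT p:S3|lborel. norm (G p))"
      by (rule set_integral_norm_bound) (rule iG', auto simp: S3_def S1_def S2_def)
    also have "\<dots> \<le> integral\<^sup>L lborel ?D"
      unfolding set_lebesgue_integral_def
    proof (rule integral_mono)
      show "integrable lborel (\<lambda>p. indicat_real S3 p *\<^sub>R norm (G p))"
        using set_integrable_norm[OF iG'[of S3]] S_sets by (auto simp: S3_def set_integrable_def)
      show "integrable lborel ?D" using i1 i2 by (intro integrable_mult_right Bochner_Integration.integrable_add)
      show "indicat_real S3 p *\<^sub>R norm (G p) \<le> ?D p" for p
      proof (cases "p \<in> S3")
        case False
        then show ?thesis using M0 w0[of p] by (simp add: mult_nonneg_nonneg)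
      next
        case True
        then have p: "p \<in> {p1<..p2}" "p \<notin> S1" "p \<notin> S2" by (auto simp: S3_def)
        have g: "norm (G p) \<le> M * w p"
          using mult_right_mono[OF uM[of p] w0[of p]] p by (simp add: nG mult.commute)
        have "w p \<le> indicator {p1<..p1 + \<delta>} p * w p
            + indicator {p0 - \<delta>..p0 + \<delta>} p * \<delta> powr (\<mu> - 1)"
        proof (cases "p \<le> p1 + \<delta>")
          case True
          then show ?thesis using p by simp
        next
          case False
          then have "p \<in> {p0 - \<delta>..p0 + \<delta>}" using p by (auto simp: S1_def S2_def)
          then show ?thesis using w_le[of p] False by simp
        qed
        then have "M * w p \<le> ?D p" using M0 by (rule mult_left_mono)
        with g True show ?thesis by simp
      qed
    qed
    also have "\<dots> = M * ((LINT p:{p1<..p1 + \<delta>}|lborel. w p)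
        + (LINT p|lborel. indicator {p0 - \<delta>..p0 + \<delta>} p * \<delta> powr (\<mu> - 1)))"
      using i1 i2 by (simp add: set_lebesgue_integral_def)
    also have "\<dots> = M * (\<delta> powr \<mu> / \<mu> + 2 * \<delta> powr \<mu>)"
      using iw(2)[of "p1 + \<delta>"] de0 by (simp add: powr_diff)
    also have "\<dots> \<le> M * (3 / \<mu> * \<delta> powr \<mu>)"
    proof (rule mult_left_mono[OF _ M0])
      \<comment> \<open>Here \<open>\<mu> \<le> 1\<close> is what merges
        \<open>1 / \<mu> + 2\<close> into the single constant \<open>3 / \<mu>\<close>.\<close>
      have "2 * \<delta> powr \<mu> \<le> 2 / \<mu> * \<delta> powr \<mu>"
        using mu0 mu1 by (intro mult_right_mono) (auto simp: field_simps)
      then show "\<delta> powr \<mu> / \<mu> + 2 * \<delta> powr \<mu> \<le> 3 / \<mu> * \<delta> powr \<mu>"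
        by (simp add: field_simps)
    qed
    finally show ?thesis .
  qed

  \<comment> \<open>Adding up the three contributions\<close>
  have "(LINT p:{p1<..p2}|lborel. U p * exp (\<i> * of_real (\<omega> * \<psi> p)))
      = (LINT p:{p1<..p2}|lborel. G p)"
    by (rule set_lebesgue_integral_cong) (auto simp: U G_def w_def)
  \<comment> \<open>The two far intervals, each costing \<open>4 * M + V\<close>, produce the
    factors 8 and 2 in \<open>C_const\<close>; the near set produces
    \<open>3 / \<mu>\<close>.\<close>
  also have "norm \<dots> \<le> (4 * M + V) * (\<delta> powr \<mu> / m) + (4 * M + V) * (\<delta> powr \<mu> / m)
      + M * (3 / \<mu> * \<delta> powr \<mu>)"
    unfolding split by (intro norm_triangle_mono S1 S2 S3)
  also have "\<dots> = C_const p1 p2 \<mu> ut \<psi>t * \<delta> powr \<mu>"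
    unfolding C_const_def u'_def[symmetric] m_def[symmetric] V_def[symmetric] M_def[symmetric]
    using m0 mu0 by (simp add: field_simps)
  also have "\<delta> powr \<mu> = \<omega> powr (- (\<mu> / \<rho>))"
    by (simp add: \<delta>_def powr_powr)
  finally show "cmod (LINT p:{p1<..p2}|lborel. U p * exp (\<i> * of_real (\<omega> * \<psi> p)))
      \<le> C_const p1 p2 \<mu> ut \<psi>t * \<omega> powr (- (\<mu> / \<rho>))" .
qed

end
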